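(* Let $X$ be a complex Banach space and let $D=\sum_n a_n\frac1{n^s}$ be a Dirichlet series with coefficients $a_n\in X$. If $\sigma_c(x'(D))<+\infty$ for all $x'\in X'$, then $\sigma_c(D)<+\infty$.
   Context: $X'$ denotes the topological dual of $X$. For a Dirichlet series $D=\sum_n a_n\frac1{n^s}$ with coefficients in $X$ (variable $s\in\mathbb{C}$), the abscissa of convergence is $\sigma_c(D):=\inf\{r\in\mathbb{R} : \sum_n a_n\frac1{n^s}\text{ converges in }X\text{ for all } s \text{ with } \operatorname{Re}s>r\}$, the infimum being taken in the extended real line (so $\sigma_c(D)=+\infty$ if the series is nowhere convergent). For $x'\in X'$, $x'(D)$ denotes the scalar Dirichlet series $\sum_n x'(a_n)\frac1{n^s}$, and $\sigma_c(x'(D))$ is its abscissa of convergence (same definition with $X=\mathbb{C}$). *)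

theory Defs
  imports "HOL-Analysis.Analysis"
begin

text \<open>Complex Banach spaces are introduced as a type class on top of the real classes, so that the
  topology, norm and completeness are those of the library; the complex scalar multiplication has to
  extend the real one.\<close>

class complex_vector = real_vector +
  fixes scaleC :: "complex \<Rightarrow> 'a \<Rightarrow> 'a" (infixr \<open>*\<^sub>C\<close> 75)
  assumes scaleC_add_right: "c *\<^sub>C (x + y) = c *\<^sub>C x + c *\<^sub>C y"
    and scaleC_add_left: "(c + d) *\<^sub>C x = c *\<^sub>C x + d *\<^sub>C x"
    and scaleC_scaleC: "c *\<^sub>C d *\<^sub>C x = (c * d) *\<^sub>C x"
    and scaleC_of_real: "complex_of_real r *\<^sub>C x = r *\<^sub>R x"

class complex_normed_vector = complex_vector + real_normed_vector +
  assumes norm_scaleC: "norm (c *\<^sub>C x) = cmod c * norm x"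

class complex_banach = complex_normed_vector + banach

instantiation complex :: complex_banach
begin

definition scaleC_complex :: "complex \<Rightarrow> complex \<Rightarrow> complex" where
  "scaleC_complex c z = c * z"

instance
  by standard (auto simp: scaleC_complex_def algebra_simps norm_mult scaleR_conv_of_real)

end

lemma vector_space_scaleC: "vector_space (scaleC :: complex \<Rightarrow> 'a::complex_vector \<Rightarrow> 'a)"
proof
  show "1 *\<^sub>C x = x" for x :: 'a
    using scaleC_of_real[of 1 x] by simp
qed (simp_all add: scaleC_add_right scaleC_add_left scaleC_scaleC)

definition topological_dual :: "('a::complex_normed_vector \<Rightarrow> complex) set" where
  "topological_dual = {f. Vector_Spaces.linear scaleC scaleC f \<and> continuous_on UNIV f}"

text \<open>A Dirichlet series is given by its coefficient sequence \<open>a\<close>. The summation index runs over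
  \<open>n \<ge> 1\<close>, so \<open>a 0\<close> is never used and the \<open>n\<close>-th summand below has index \<open>Suc n\<close>.\<close>

definition dirichlet_converges :: "(nat \<Rightarrow> 'a::complex_normed_vector) \<Rightarrow> complex \<Rightarrow> bool" where
  "dirichlet_converges a s \<longleftrightarrow>
     summable (\<lambda>n. (1 / (of_nat (Suc n) powr s)) *\<^sub>C a (Suc n))"

definition abscissa_conv :: "(nat \<Rightarrow> 'a::complex_normed_vector) \<Rightarrow> ereal" where
  "abscissa_conv a = Inf (ereal ` {r. \<forall>s. Re s > r \<longrightarrow> dirichlet_converges a s})"

end

theory Submission
  imports Defs
begin

text \<open>The abscissa of a Dirichlet series is less than \<open>\<infinity>\<close> iff its coefficients grow at most
  polynomially. So every real functional \<open>f\<close>, being the real part of the complex functional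
  \<open>y \<mapsto> f y - \<i> f (\<i> y)\<close>, lies in one of the closed sets \<open>E m\<close> where \<open>\<bar>f (a n)\<bar> \<le> m n^m\<close> for all
  \<open>n \<ge> 1\<close>. By Baire's theorem in the real dual some \<open>E m\<close> contains a ball, which by Hahn-Banach bounds
  \<open>\<parallel>a n\<parallel>\<close> by a multiple of \<open>n^m\<close>.

  For Hahn-Banach, Zorn's lemma gives a minimal sublinear functional below a given one; minimal
  sublinear functionals are linear.\<close>

section \<open>Sublinear functionals and the Hahn-Banach theorem\<close>

definition sublinear :: "('a::real_vector \<Rightarrow> real) \<Rightarrow> bool" where
  "sublinear p \<longleftrightarrow> (\<forall>x y. p (x + y) \<le> p x + p y) \<and> (\<forall>t>0. \<forall>x. p (t *\<^sub>R x) \<le> t * p x)"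

lemma sublinear_add: "sublinear p \<Longrightarrow> p (x + y) \<le> p x + p y"
  by (simp add: sublinear_def)

text \<open>The definition asks only for \<le>, which is easier to check for infima; applying it to
  \<open>inverse t\<close> gives the other inequality.\<close>

lemma sublinear_scale_pos:
  assumes "sublinear p" "t > 0"
  shows "p (t *\<^sub>R x) = t * p x"
proof (rule antisym)
  show "p (t *\<^sub>R x) \<le> t * p x"
    using assms by (simp add: sublinear_def)
  have "p (inverse t *\<^sub>R (t *\<^sub>R x)) \<le> inverse t * p (t *\<^sub>R x)"
    using assms unfolding sublinear_def by (meson positive_imp_inverse_positive)
  then show "t * p x \<le> p (t *\<^sub>R x)"
    using assms by (simp add: field_simps)
qed

lemma sublinear_0: "sublinear p \<Longrightarrow> p 0 = 0"
  using sublinear_scale_pos[of p 2 0] by simp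

lemma sublinear_scale: "sublinear p \<Longrightarrow> t \<ge> 0 \<Longrightarrow> p (t *\<^sub>R x) = t * p x"
  by (cases "t = 0") (simp_all add: sublinear_0 sublinear_scale_pos)

lemma sublinear_minus: "sublinear p \<Longrightarrow> - p (- x) \<le> p x"
  using sublinear_add[of p x "- x"] sublinear_0[of p] by simp

lemma sublinear_norm: "sublinear (norm :: 'a::real_normed_vector \<Rightarrow> real)"
  by (auto simp: sublinear_def norm_triangle_ineq)

text \<open>Any sublinear \<open>p\<close> has a sublinear minorant \<open>q\<close> whose linear minorants all take the value \<open>p x\<close>
  at \<open>x\<close>, because \<open>q (- x) \<le> - p x\<close>.\<close>

lemma sublinear_minorant:
  assumes p: "sublinear p"
  obtains q where "sublinear q" "\<And>y. q y \<le> p y" "\<And>y. q y \<le> p (y + x) - p x"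
proof -
  \<comment> \<open>The parameters \<open>t = 0\<close> and \<open>t = 1\<close> give the two
    required upper bounds. Admitting all \<open>t \<ge> 0\<close> makes \<open>q\<close>
    subadditive: parameters \<open>t\<close> and \<open>u\<close> of two summands combine to
    \<open>t + u\<close>.\<close>
  define q where "q y = (INF t\<in>{0..}. p (y + t *\<^sub>R x) - t * p x)" for y
  have bdd: "bdd_below ((\<lambda>t. p (y + t *\<^sub>R x) - t * p x) ` {0..})" for y
  proof (rule bdd_belowI2)
    fix t :: real assume "t \<in> {0..}"
    then show "- p (- y) \<le> p (y + t *\<^sub>R x) - t * p x"
      using sublinear_add[OF p, of "y + t *\<^sub>R x" "- y"] sublinear_scale[OF p, of t x] by simp
  qed
  have q_le: "q y \<le> p (y + t *\<^sub>R x) - t * p x" if "t \<ge> 0" for t y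
    unfolding q_def using that by (intro cINF_lower bdd) auto
  have q_ge: "c \<le> q y" if "\<And>t. t \<ge> 0 \<Longrightarrow> c \<le> p (y + t *\<^sub>R x) - t * p x" for c y
    unfolding q_def using that by (intro cINF_greatest) auto
  have "q (y + z) \<le> q y + q z" for y z
  proof -
    have "q (y + z) - (p (y + t *\<^sub>R x) - t * p x) \<le> q z" if "t \<ge> 0" for t
    proof (rule q_ge)
      fix u :: real assume "u \<ge> 0"
      have "q (y + z) \<le> p ((y + z) + (t + u) *\<^sub>R x) - (t + u) * p x"
        using \<open>t \<ge> 0\<close> \<open>u \<ge> 0\<close> by (intro q_le) simp
      also have "p ((y + z) + (t + u) *\<^sub>R x) \<le> p (y + t *\<^sub>R x) + p (z + u *\<^sub>R x)"
        using sublinear_add[OF p, of "y + t *\<^sub>R x" "z + u *\<^sub>R x"] by (simp add: algebra_simps)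
      finally show "q (y + z) - (p (y + t *\<^sub>R x) - t * p x) \<le> p (z + u *\<^sub>R x) - u * p x"
        by (simp add: algebra_simps)
    qed
    then have "q (y + z) - q z \<le> q y"
      by (intro q_ge) (simp add: algebra_simps)
    then show ?thesis by simp
  qed
  moreover have "q (c *\<^sub>R y) \<le> c * q y" if "c > 0" for c y
  proof -
    have "q (c *\<^sub>R y) / c \<le> q y"
    proof (rule q_ge)
      fix t :: real assume "t \<ge> 0"
      \<comment> \<open>Rescaling by \<open>c\<close> turns the parameter \<open>t\<close> for
        \<open>y\<close> into \<open>c * t\<close> for \<open>c *\<^sub>R y\<close>.\<close>
      have "q (c *\<^sub>R y) \<le> p (c *\<^sub>R y + (c * t) *\<^sub>R x) - (c * t) * p x"
        using \<open>t \<ge> 0\<close> \<open>c > 0\<close> by (intro q_le) simp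
      also have "p (c *\<^sub>R y + (c * t) *\<^sub>R x) = c * p (y + t *\<^sub>R x)"
        using sublinear_scale_pos[OF p \<open>c > 0\<close>, of "y + t *\<^sub>R x"] by (simp add: algebra_simps)
      finally show "q (c *\<^sub>R y) / c \<le> p (y + t *\<^sub>R x) - t * p x"
        using \<open>c > 0\<close> by (simp add: field_simps)
    qed
    then show ?thesis
      using \<open>c > 0\<close> by (simp add: field_simps)
  qed
  ultimately have "sublinear q"
    by (simp add: sublinear_def)
  with q_le[of 0] q_le[of 1] show ?thesis
    by (intro that[of q]) simp_all
qed

text \<open>Zorn's lemma for the reversed pointwise order: the pointwise infimum of a nonempty chain
  is again sublinear.\<close>

lemma minimal_sublinear_exists:
  assumes p0: "sublinear p0"
  obtains p where "sublinear p" "p \<le> p0" "\<And>q. sublinear q \<Longrightarrow> q \<le> p \<Longrightarrow> q = p"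
proof -
  let ?A = "{p. sublinear p \<and> p \<le> p0}"
  have "\<exists>m\<in>?A. \<forall>q\<in>?A. q \<le> m \<longrightarrow> q = m"
  proof (rule predicate_Zorn)
    show "partial_order_on ?A (relation_of (\<lambda>p q. q \<le> p) ?A)"
      by (rule partial_order_on_relation_ofI) auto
    fix C assume C: "C \<in> Chains (relation_of (\<lambda>p q. q \<le> p) ?A)"
    then have CA: "C \<subseteq> ?A"
      by (rule Chains_relation_of)
    have total: "p \<le> q \<or> q \<le> p" if "p \<in> C" "q \<in> C" for p q
      using C that by (auto simp: Chains_def relation_of_def)
    show "\<exists>u\<in>?A. \<forall>q\<in>C. u \<le> q"
    proof (cases "C = {}")
      case True
      then show ?thesis using p0 by auto
    next
      case False
      define u where "u x = (INF p\<in>C. p x)" for x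
      \<comment> \<open>The infimum is a real number since
        \<open>p x \<ge> - p (- x) \<ge> - p0 (- x)\<close> throughout the chain.\<close>
      have bdd: "bdd_below ((\<lambda>p. p x) ` C)" for x
      proof (rule bdd_belowI2)
        fix p assume "p \<in> C"
        then have "sublinear p" "p (- x) \<le> p0 (- x)"
          using CA by (auto simp: le_fun_def)
        then show "- p0 (- x) \<le> p x"
          using sublinear_minus[of p x] by simp
      qed
      have u_le: "u x \<le> p x" if "p \<in> C" for p x
        unfolding u_def using that by (intro cINF_lower bdd)
      have u_ge: "c \<le> u x" if "\<And>p. p \<in> C \<Longrightarrow> c \<le> p x" for c x
        unfolding u_def using that False by (intro cINF_greatest)
      have "u (x + y) \<le> u x + u y" for x y
      proof -
        have "u (x + y) - p x \<le> q y" if "p \<in> C" "q \<in> C" for p q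
        proof -
          \<comment> \<open>The smaller of \<open>p\<close> and \<open>q\<close> bounds both
            summands at once; this is where the chain property enters.\<close>
          obtain r where r: "r \<in> C" "r \<le> p" "r \<le> q"
            using total[OF \<open>p \<in> C\<close> \<open>q \<in> C\<close>] \<open>p \<in> C\<close> \<open>q \<in> C\<close> by (metis order_refl)
          have "u (x + y) \<le> r (x + y)"
            by (rule u_le[OF r(1)])
          also have "\<dots> \<le> r x + r y"
            using r(1) CA by (intro sublinear_add) auto
          also have "\<dots> \<le> p x + q y"
            using r by (intro add_mono) (auto simp: le_fun_def)
          finally show ?thesis by simp
        qed
        then have "u (x + y) - p x \<le> u y" if "p \<in> C" for p
          using that by (intro u_ge)
        then have "u (x + y) - u y \<le> u x"
          by (intro u_ge) (simp add: algebra_simps)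
        then show ?thesis by simp
      qed
      moreover have "u (t *\<^sub>R x) \<le> t * u x" if "t > 0" for t x
      proof -
        have "u (t *\<^sub>R x) / t \<le> u x"
        proof (rule u_ge)
          fix p assume "p \<in> C"
          then have "p (t *\<^sub>R x) = t * p x"
            using CA \<open>t > 0\<close> by (intro sublinear_scale_pos) auto
          then show "u (t *\<^sub>R x) / t \<le> p x"
            using u_le[OF \<open>p \<in> C\<close>, of "t *\<^sub>R x"] \<open>t > 0\<close> by (simp add: field_simps)
        qed
        then show ?thesis
          using \<open>t > 0\<close> by (simp add: field_simps)
      qed
      ultimately have "sublinear u"
        by (simp add: sublinear_def)
      moreover obtain p where "p \<in> C"
        using False by blast
      then have "u \<le> p0"
        using u_le[of p] CA by (force simp: le_fun_def intro: order_trans)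
      ultimately show ?thesis
        using u_le by (intro bexI[of _ u]) (auto simp: le_fun_def)
    qed
  qed
  then obtain m where "m \<in> ?A" and "\<forall>q\<in>?A. q \<le> m \<longrightarrow> q = m"
    by blast
  then show ?thesis
    by (intro that[of m]) (auto intro: order_trans)
qed

text \<open>A minimal \<open>p\<close> equals its minorant \<open>q\<close> in the direction
  \<open>y\<close>, so \<open>q x \<le> p (x + y) - p y\<close> becomes the reverse of
  subadditivity.\<close>

lemma linear_minorant_exists:
  assumes "sublinear p0"
  obtains f where "linear f" "\<And>y. f y \<le> p0 y"
proof -
  obtain p where p: "sublinear p" "p \<le> p0" and min: "\<And>q. sublinear q \<Longrightarrow> q \<le> p \<Longrightarrow> q = p"
    using minimal_sublinear_exists[OF assms] by blast
  have add: "p (x + y) = p x + p y" for x y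
  proof (rule antisym)
    obtain q where q: "sublinear q" "\<And>z. q z \<le> p z" "\<And>z. q z \<le> p (z + y) - p y"
      using sublinear_minorant[OF p(1)] by blast
    have "q = p"
      using q by (intro min) (auto simp: le_fun_def)
    then show "p x + p y \<le> p (x + y)"
      using q(3)[of x] by simp
  qed (rule sublinear_add[OF p(1)])
  have minus: "p (- x) = - p x" for x
    using add[of x "- x"] sublinear_0[OF p(1)] by simp
  have "p (t *\<^sub>R x) = t * p x" for t x
    using sublinear_scale[OF p(1), of t x] sublinear_scale[OF p(1), of "- t" x] minus[of "t *\<^sub>R x"]
    by (cases "t \<ge> 0") auto
  then have "linear p"
    using add by (intro linearI) auto
  then show ?thesis
    using p(2) by (intro that[of p]) (auto simp: le_fun_def)
qed

text \<open>A linear functional below the norm need not attain \<open>norm x\<close> at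
  \<open>x\<close>. One below \<open>q\<close> also satisfies
  \<open>f (- x) \<le> norm (- x + x) - norm x\<close>, which forces
  \<open>f x = norm x\<close>.\<close>

lemma norming_functional:
  fixes x :: "'a::real_normed_vector"
  obtains f :: "'a \<Rightarrow>\<^sub>L real" where "norm f \<le> 1" "blinfun_apply f x = norm x"
proof -
  obtain q :: "'a \<Rightarrow> real" where q: "sublinear q" "\<And>y. q y \<le> norm y"
      "\<And>y. q y \<le> norm (y + x) - norm x"
    using sublinear_minorant[OF sublinear_norm] by blast
  obtain f where f: "linear f" "\<And>y. f y \<le> q y"
    using linear_minorant_exists[OF q(1)] by blast
  have f_le: "f y \<le> norm y" for y
    using f(2) q(2) order_trans by blast
  have f_abs: "\<bar>f y\<bar> \<le> norm y" for y
    using f_le[of y] f_le[of "- y"] by (simp add: linear_neg[OF f(1)])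
  have bl: "bounded_linear f"
    using f(1) f_abs by (intro bounded_linear_intro[of f 1])
      (auto simp: linear_add linear_scale)
  have "f (- x) \<le> - norm x"
    using f(2)[of "- x"] q(3)[of "- x"] by simp
  then have "f x = norm x"
    using f_le[of x] by (simp add: linear_neg[OF f(1)])
  then show ?thesis
    using bl f_abs
    by (intro that[of "Blinfun f"] norm_blinfun_bound) (auto simp: bounded_linear_Blinfun_apply)
qed

section \<open>Complex functionals from real ones\<close>

lemma bounded_linear_scaleC_right:
  "bounded_linear (\<lambda>x::'a::complex_normed_vector. c *\<^sub>C x)"
proof (rule bounded_linear_intro[where K = "cmod c"])
  show "c *\<^sub>C r *\<^sub>R x = r *\<^sub>R c *\<^sub>C x" for r and x :: 'a
    by (simp add: scaleC_scaleC mult.commute flip: scaleC_of_real)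
qed (auto simp: scaleC_add_right norm_scaleC mult.commute)

lemma complexified_functional_in_dual:
  fixes f :: "'a::complex_normed_vector \<Rightarrow>\<^sub>L real"
  shows "(\<lambda>y. Complex (f y) (- f (\<i> *\<^sub>C y))) \<in> topological_dual"
proof -
  define F where "F = (\<lambda>y. Complex (f y) (- f (\<i> *\<^sub>C y)))"
  have scale: "f (c *\<^sub>C y) = Re c * f y + Im c * f (\<i> *\<^sub>C y)" for c y
  proof -
    have "c *\<^sub>C y = Re c *\<^sub>R y + Im c *\<^sub>R \<i> *\<^sub>C y"
      using complex_eq[of c]
      by (metis mult.commute scaleC_add_left scaleC_of_real scaleC_scaleC)
    then show ?thesis
      by (simp add: blinfun.bilinear_simps)
  qed
  have "F (x + y) = F x + F y" for x y
    by (simp add: F_def complex_eq_iff scaleC_add_right blinfun.add_right)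
  moreover have "F (c *\<^sub>C y) = c *\<^sub>C F y" for c y
    \<comment> \<open>The instance at \<open>c\<close> settles the real parts, the one at
      \<open>\<i> * c\<close> the imaginary parts.\<close>
    using scale[of c y] scale[of "\<i> * c" y]
    by (simp add: F_def complex_eq_iff scaleC_complex_def scaleC_scaleC)
  ultimately have "Vector_Spaces.linear scaleC scaleC F"
    by (simp add: Vector_Spaces.linear_def module_hom_iff module_iff_vector_space
        vector_space_scaleC)
  moreover have "continuous_on UNIV F"
    unfolding F_def
    by (intro continuous_on_Complex continuous_intros
        linear_continuous_on bounded_linear_scaleC_right)
  ultimately show ?thesis
    by (simp add: topological_dual_def F_def)
qed

section \<open>Abscissa of convergence and growth of the coefficients\<close>

lemma abscissa_conv_less_top_iff:
  "abscissa_conv a < \<infinity> \<longleftrightarrow> (\<exists>r. \<forall>s. Re s > r \<longrightarrow> dirichlet_converges a s)"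
  unfolding abscissa_conv_def Inf_less_iff by auto

lemma norm_dirichlet_term:
  fixes x :: "'a::complex_normed_vector"
  shows "norm ((1 / (of_nat (Suc n) powr s)) *\<^sub>C x) = norm x / real (Suc n) powr Re s"
proof -
  have "cmod (of_nat (Suc n) powr s) = real (Suc n) powr Re s"
    by (subst norm_powr_real_powr) simp_all
  then show ?thesis
    by (simp add: norm_scaleC norm_divide del: of_nat_Suc)
qed

text \<open>Convergence at an integer \<open>k\<close> bounds the terms of the series there. One
  \<open>m\<close> serves as both factor and exponent, so that a single natural number indexes the
  sets in the Baire argument.\<close>

lemma polynomial_growth_if_abscissa_conv:
  assumes "abscissa_conv a < \<infinity>"
  obtains m :: nat where "\<And>n. norm (a (Suc n)) \<le> real m * real (Suc n) ^ m"
proof -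
  obtain r where r: "\<And>s. Re s > r \<Longrightarrow> dirichlet_converges a s"
    using assms unfolding abscissa_conv_less_top_iff by blast
  obtain k :: nat where "r < real k"
    using reals_Archimedean2 by blast
  then have "summable (\<lambda>n. (1 / (of_nat (Suc n) powr of_nat k)) *\<^sub>C a (Suc n))"
    using r[of "of_nat k"] by (simp add: dirichlet_converges_def)
  then have "Bseq (\<lambda>n. (1 / (of_nat (Suc n) powr of_nat k)) *\<^sub>C a (Suc n))"
    by (intro convergent_imp_Bseq convergentI[of _ 0] summable_LIMSEQ_zero)
  then obtain C where C: "\<And>n. norm ((1 / (of_nat (Suc n) powr of_nat k)) *\<^sub>C a (Suc n)) \<le> C"
    by (auto simp: Bseq_def)
  obtain l :: nat where "C \<le> real l"
    using real_arch_simple by blast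
  have "norm (a (Suc n)) \<le> real (max k l) * real (Suc n) ^ max k l" for n
  proof -
    have "norm (a (Suc n)) \<le> C * real (Suc n) ^ k"
      using C[of n] unfolding norm_dirichlet_term
      by (simp add: powr_realpow field_simps del: of_nat_Suc)
    \<comment> \<open>The exponent may be enlarged because \<open>Suc n \<ge> 1\<close>.\<close>
    also have "\<dots> \<le> real (max k l) * real (Suc n) ^ max k l"
      using \<open>C \<le> real l\<close> by (intro mult_mono power_increasing) auto
    finally show ?thesis .
  qed
  then show ?thesis by (rule that)
qed

text \<open>For \<open>Re s > m + 2\<close> the terms are dominated by a multiple of the inverse
  squares, so the series converges absolutely and hence, by completeness, converges.\<close>

lemma abscissa_conv_if_polynomial_growth:
  fixes a :: "nat \<Rightarrow> 'a::complex_banach"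
  assumes "\<And>n. norm (a (Suc n)) \<le> C * real (Suc n) ^ m"
  shows "abscissa_conv a < \<infinity>"
  unfolding abscissa_conv_less_top_iff
proof (intro exI allI impI)
  fix s :: complex assume s: "Re s > real (m + 2)"
  have "0 \<le> C"
    using order_trans[OF norm_ge_zero assms[of 0]] by simp
  show "dirichlet_converges a s"
    unfolding dirichlet_converges_def
  proof (rule summable_comparison_test'[where N = 0])
    show "summable (\<lambda>n. C * inverse (real (Suc n) ^ 2))"
      using inverse_power_summable[of 2, where 'a = real]
      by (intro summable_mult) (subst summable_Suc_iff, simp)
    fix n :: nat
    have "norm (a (Suc n)) / real (Suc n) powr Re s \<le> (C * real (Suc n) ^ m) / real (Suc n) powr real (m + 2)"
      using s assms[of n] \<open>0 \<le> C\<close> by (intro frac_le powr_mono) auto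
    also have "\<dots> = C * inverse (real (Suc n) ^ 2)"
      by (simp add: powr_realpow power_add power2_eq_square field_simps del: of_nat_Suc of_nat_add)
    finally show "norm ((1 / (of_nat (Suc n) powr s)) *\<^sub>C a (Suc n)) \<le> C * inverse (real (Suc n) ^ 2)"
      unfolding norm_dirichlet_term .
  qed
qed

section \<open>Uniform growth bound by Baire category\<close>

theorem corollary2p4:
  fixes a :: "nat \<Rightarrow> 'a::complex_banach"
  assumes "\<And>f. f \<in> (topological_dual :: ('a \<Rightarrow> complex) set) \<Longrightarrow>
    abscissa_conv (\<lambda>n. f (a n)) < \<infinity>"
  shows "abscissa_conv a < \<infinity>"
proof -
  define E where
    "E m = {f :: 'a \<Rightarrow>\<^sub>L real. \<forall>n. \<bar>f (a (Suc n))\<bar> \<le> real m * real (Suc n) ^ m}" for m :: nat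
  have "f \<in> (\<Union>m. E m)" for f
  proof -
    obtain m where m: "\<And>n. cmod (Complex (f (a (Suc n))) (- f (\<i> *\<^sub>C a (Suc n))))
        \<le> real m * real (Suc n) ^ m"
      using polynomial_growth_if_abscissa_conv[OF assms[OF complexified_functional_in_dual[of f]]]
      by blast
    have "\<bar>f (a (Suc n))\<bar> \<le> real m * real (Suc n) ^ m" for n
      using order_trans[OF abs_Re_le_cmod m[of n]] by simp
    then show ?thesis
      by (auto simp: E_def)
  qed
  then have union: "(\<Union>m. E m) = UNIV"
    by blast
  have closed: "closed (E m)" for m
    unfolding E_def by (intro closed_Collect_all closed_Collect_le continuous_intros)
  have "\<exists>m. interior (E m) \<noteq> {}"
  proof (rule ccontr)
    assume "\<nexists>m. interior (E m) \<noteq> {}"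
    \<comment> \<open>The dual is complete because the functionals take values in
      \<open>real\<close>, so Baire's theorem applies to it.\<close>
    then have "euclidean interior_of \<Union>(range E) = {}"
      using closed by (intro Baire_category_alt disjI1 completely_metrizable_space_euclidean) auto
    then show False
      using union by simp
  qed
  then obtain m f e where "e > 0" and ball: "cball f e \<subseteq> E m"
    by (auto simp: mem_interior_cball)
  \<comment> \<open>Both \<open>f\<close> and \<open>f + e *\<^sub>R g\<close> lie in the ball, so
    their difference \<open>e *\<^sub>R g\<close> obeys twice the bound of \<open>E m\<close>. The
    functional \<open>g\<close> varies with \<open>n\<close>, but \<open>f\<close>, \<open>e\<close>
    and \<open>m\<close> do not.\<close>
  have "norm (a (Suc n)) \<le> (2 * real m / e) * real (Suc n) ^ m" for n
  proof -
    obtain g :: "'a \<Rightarrow>\<^sub>L real" where g: "norm g \<le> 1" "g (a (Suc n)) = norm (a (Suc n))"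
      using norming_functional by blast
    have "f + e *\<^sub>R g \<in> E m" "f \<in> E m"
      using ball g(1) \<open>e > 0\<close> by (auto simp: subset_iff dist_norm)
    then have "\<bar>f (a (Suc n)) + e * norm (a (Suc n))\<bar> \<le> real m * real (Suc n) ^ m"
      "\<bar>f (a (Suc n))\<bar> \<le> real m * real (Suc n) ^ m"
      by (simp_all add: E_def blinfun.bilinear_simps g(2)[symmetric] del: of_nat_Suc)
    then have "e * norm (a (Suc n)) \<le> 2 * (real m * real (Suc n) ^ m)"
      by linarith
    then show ?thesis
      using \<open>e > 0\<close> by (simp add: field_simps del: of_nat_Suc)
  qed
  then show ?thesis
    by (rule abscissa_conv_if_polynomial_growth)
qed

end
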